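(* Let $f\in\mathcal{S}$ be given by $f(z)=z+a_2z^2+a_3z^3+\cdots$ for $z\in\mathbb{D}$, and let $\gamma_1,\gamma_2,\gamma_3$ be its first three logarithmic coefficients. Then $$|H_{2,1}(F_f/2)|=\left|\gamma_1\gamma_3-\gamma_2^2\right|\le\frac13.$$
   Context: $\mathbb{D}=\{z\in\mathbb{C}:|z|<1\}$ is the open unit disk. $\mathcal{A}$ is the class of functions $f$ analytic in $\mathbb{D}$ of the form $f(z)=z+a_2z^2+a_3z^3+\cdots$ (i.e. $f(0)=0$, $f'(0)=1$), with complex coefficients $a_n$. $\mathcal{S}$ is the subclass of $\mathcal{A}$ consisting of the functions that are univalent (injective) in $\mathbb{D}$. For $f\in\mathcal{S}$ the logarithmic coefficients $\gamma_n$ are defined by $$F_f(z):=\log\frac{f(z)}{z}=2\sum_{n=1}^{\infty}\gamma_nz^n,\qquad z\in\mathbb{D},$$ where $f(z)/z$ is understood to equal $1$ at $z=0$ and the analytic branch of the logarithm with value $0$ at $z=0$ is taken. The second Hankel determinant for the logarithmic coefficients is the determinant of the $2\times2$ Hankel matrix formed from the Taylor coefficients $\gamma_n$ of $F_f/2$: $$H_{2,1}(F_f/2)=\left|\begin{array}{cc}\gamma_1&\gamma_2\\ \gamma_2&\gamma_3\end{array}\right|=\gamma_1\gamma_3-\gamma_2^2.$$ *)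

theory Defs
  imports "HOL-Complex_Analysis.Complex_Analysis"
begin

definition class_A :: "(complex \<Rightarrow> complex) set" where
  "class_A = {f. f holomorphic_on ball 0 1 \<and> f 0 = 0 \<and> deriv f 0 = 1}"

definition class_S :: "(complex \<Rightarrow> complex) set" where
  "class_S = {f \<in> class_A. inj_on f (ball 0 1)}"

definition is_log_quotient :: "(complex \<Rightarrow> complex) \<Rightarrow> (complex \<Rightarrow> complex) \<Rightarrow> bool" where
  "is_log_quotient f F \<longleftrightarrow> F holomorphic_on ball 0 1 \<and> F 0 = 0 \<and>
     (\<forall>z\<in>ball 0 1. exp (F z) = (if z = 0 then 1 else f z / z))"

(* The conditions determine the function on the disk only, so no unique total function satisfies
   them. For f in class_S they can be satisfied, and any choice has the same values on the disk;
   see is_log_quotient_log_quotient and is_log_quotient_unique. *)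
definition log_quotient :: "(complex \<Rightarrow> complex) \<Rightarrow> complex \<Rightarrow> complex" where
  "log_quotient f = (SOME F. is_log_quotient f F)"

definition log_coeff :: "(complex \<Rightarrow> complex) \<Rightarrow> nat \<Rightarrow> complex" where
  "log_coeff f n = fps_nth (fps_expansion (log_quotient f) 0) n / 2"

(* H_{2,n}(g), with entries the Taylor coefficients of g at 0 of index n, n+1, n+2. *)
definition hankel2 :: "nat \<Rightarrow> (complex \<Rightarrow> complex) \<Rightarrow> complex" where
  "hankel2 n g = (let c = fps_nth (fps_expansion g 0) in
     det (vector [vector [c n, c (n + 1)], vector [c (n + 1), c (n + 2)]] :: complex^2^2))"

lemma ex_is_log_quotient:
  assumes "f \<in> class_S"
  shows "\<exists>F. is_log_quotient f F"
proof -
  have hol: "f holomorphic_on ball 0 1" and f0: "f 0 = 0" and d: "deriv f 0 = 1"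
    and inj: "inj_on f (ball 0 1)"
    using assms by (auto simp: class_S_def class_A_def)
  define g where "g = (\<lambda>z. if z = 0 then 1 else f z / z)"
  have "g holomorphic_on ball 0 1"
    using pole_lemma_open[OF hol open_ball, of 0] by (simp add: g_def f0 d cong: if_cong)
  moreover have "g z \<noteq> 0" if "z \<in> ball 0 1" for z
    using inj_onD[OF inj, of z 0] that f0 by (auto simp: g_def)
  ultimately obtain G where G: "G holomorphic_on ball 0 1"
      "\<And>z. z \<in> ball 0 1 \<Longrightarrow> exp (G z) = g z"
    using holomorphic_logarithm_exists[of "ball 0 1" g 0] by auto
  have "exp (G 0) = 1"
    using G(2)[of 0] by (simp add: g_def)
  then have "is_log_quotient f (\<lambda>z. G z - G 0)"
    using G unfolding is_log_quotient_def g_def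
    by (auto intro!: holomorphic_intros simp: exp_diff)
  then show ?thesis by blast
qed

lemma is_log_quotient_log_quotient:
  assumes "f \<in> class_S"
  shows "is_log_quotient f (log_quotient f)"
  unfolding log_quotient_def using ex_is_log_quotient[OF assms] by (rule someI_ex)

lemma is_log_quotient_unique:
  assumes F: "is_log_quotient f F" and G: "is_log_quotient f G" and z: "z \<in> ball 0 1"
  shows "F z = G z"
proof -
  have hF: "F holomorphic_on ball 0 1" and hG: "G holomorphic_on ball 0 1"
    and eq: "\<And>w. w \<in> ball 0 1 \<Longrightarrow> exp (F w) = exp (G w)"
    and F0: "F 0 = 0" "G 0 = 0"
    using F G by (auto simp: is_log_quotient_def)
  have "deriv (\<lambda>w. F w - G w) w = 0" if w: "w \<in> ball 0 1" for w
  proof -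
    have dF: "(F has_field_derivative deriv F w) (at w)"
      and dG: "(G has_field_derivative deriv G w) (at w)"
      using holomorphic_derivI[OF hF open_ball w] holomorphic_derivI[OF hG open_ball w] by auto
    have 1: "((\<lambda>u. exp (F u)) has_field_derivative exp (F w) * deriv F w) (at w)"
      and 2: "((\<lambda>u. exp (G u)) has_field_derivative exp (G w) * deriv G w) (at w)"
      using dF dG by (auto intro!: derivative_eq_intros)
    have "((\<lambda>u. exp (F u)) has_field_derivative exp (G w) * deriv G w) (at w)"
      by (rule has_field_derivative_transform_within_open[OF 2 open_ball w]) (simp add: eq)
    then have "exp (F w) * deriv F w = exp (G w) * deriv G w"
      by (rule DERIV_unique[OF 1])
    then have "deriv F w = deriv G w"
      by (simp add: eq[OF w])
    then show ?thesis
      using DERIV_imp_deriv[OF DERIV_diff[OF dF dG]] by simp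
  qed
  then have "((\<lambda>w. F w - G w) has_field_derivative 0) (at w within ball 0 1)"
    if "w \<in> ball 0 1" for w
    using holomorphic_derivI[OF holomorphic_on_diff[OF hF hG] open_ball that] that
    by (simp add: has_field_derivative_at_within)
  then obtain c where c: "\<And>w. w \<in> ball 0 1 \<Longrightarrow> F w - G w = c"
    using has_field_derivative_zero_constant[OF convex_ball, of 0 1 "\<lambda>w. F w - G w"] by blast
  show ?thesis
    using c[OF z] c[of 0] F0 by simp
qed

lemma log_coeff_sums:
  assumes "f \<in> class_S" and "z \<in> ball 0 1"
  shows "(\<lambda>n. 2 * (log_coeff f (Suc n) * z ^ Suc n)) sums log_quotient f z"
proof -
  have hol: "log_quotient f holomorphic_on ball 0 1" and "log_quotient f 0 = 0"
    using is_log_quotient_log_quotient[OF assms(1)] by (auto simp: is_log_quotient_def)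
  then have "(\<lambda>n. 2 * (log_coeff f n * z ^ n)) sums log_quotient f z" "log_coeff f 0 = 0"
    using holomorphic_power_series[OF hol assms(2)]
    by (simp_all add: log_coeff_def fps_expansion_def mult.assoc)
  then show ?thesis
    using sums_Suc_iff[of "\<lambda>n. 2 * (log_coeff f n * z ^ n)"] by simp
qed

end

theory Submission
  imports Defs
begin

text \<open>
  Put \<open>E = exp (- F / 2)\<close> with \<open>F = log (f z / z)\<close>, and \<open>k z = E (z\<^sup>2)\<close>. Then \<open>h z = k z / z\<close> is the
  reciprocal of the odd square root transform \<open>sqrt (f (z\<^sup>2))\<close>, hence injective on the punctured disk.
  Gronwall's area theorem for \<open>h\<close> bounds the coefficients of \<open>E\<close> by
  \<open>|e\<^sub>1|\<^sup>2 + 3|e\<^sub>2|\<^sup>2 + 5|e\<^sub>3|\<^sup>2 \<le> 1\<close>, and the determinant equals \<open>e\<^sub>1e\<^sub>3 - e\<^sub>2\<^sup>2 + e\<^sub>1\<^sup>4/12\<close>.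

  The area theorem is obtained without Green's formula. With \<open>c\<^sub>1, c\<^sub>2\<close> the coefficients of \<open>k\<close>, the
  real-linear map \<open>w \<mapsto> w - c\<^sub>2 \<epsilon>\<^sup>2 cnj w\<close> turns the near-ellipse that \<open>h - c\<^sub>1\<close> makes of the circle
  \<open>|z| = \<epsilon>\<close> into a circle up to \<open>O(\<epsilon>\<^sup>2)\<close>. Under the composite the annulus \<open>\<epsilon> < |z| < r\<close> therefore
  lands in a disk of radius \<open>1/\<epsilon> + O(\<epsilon>\<^sup>2)\<close>, while the area of its image is bounded below by Bessel's inequality
  on circles; finally \<open>\<epsilon> \<rightarrow> 0\<close> and \<open>r \<rightarrow> 1\<close>.
\<close>

subsection \<open>Areas of injective images\<close>

text \<open>A real-linear map \<open>v \<mapsto> \<alpha> * v + \<beta> * cnj v\<close> has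
  determinant |\<alpha>|^2 - |\<beta>|^2. By injectivity and change of variables, the iterated
  integral is therefore the area of the image, which fits in a disk of radius \<open>R\<close>. The
  term in \<open>cnj v\<close> is allowed because the map studied later need not be
  holomorphic.\<close>

lemma area_image_le:
  fixes G \<alpha> \<beta> :: "complex \<Rightarrow> complex" and a b c d R :: real
  assumes der: "\<And>z. z \<in> box (Complex a c) (Complex b d) \<Longrightarrow>
                  (G has_derivative (\<lambda>v. \<alpha> z * v + \<beta> z * cnj v)) (at z)"
    and inj: "inj_on G (box (Complex a c) (Complex b d))"
    and sub: "G ` box (Complex a c) (Complex b d) \<subseteq> cball 0 R" and R: "0 \<le> R"
    and cont: "continuous_on (cbox (Complex a c) (Complex b d)) \<alpha>"
              "continuous_on (cbox (Complex a c) (Complex b d)) \<beta>"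
  shows "integral {a..b} (\<lambda>s. integral {c..d}
           (\<lambda>t. \<bar>(cmod (\<alpha> (Complex s t)))\<^sup>2 - (cmod (\<beta> (Complex s t)))\<^sup>2\<bar>)) \<le> pi * R\<^sup>2"
proof -
  \<comment> \<open>\<open>p\<close> and \<open>q\<close> are mutually inverse isometries between
    the plane as \<open>real^2\<close>, where determinant and change of variables are available, and
    as \<open>complex\<close>.\<close>
  define p :: "real^2 \<Rightarrow> complex" where "p = (\<lambda>x. Complex (vec_nth x 1) (vec_nth x 2))"
  define q :: "complex \<Rightarrow> real^2" where "q = (\<lambda>z. vector [Re z, Im z])"
  define g' where "g' = (\<lambda>x v. q (\<alpha> (p x) * p v + \<beta> (p x) * cnj (p v)))"
  define J where "J = (\<lambda>z. \<bar>(cmod (\<alpha> z))\<^sup>2 - (cmod (\<beta> z))\<^sup>2\<bar>)"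
  define S where "S = box (q (Complex a c)) (q (Complex b d))"
  have pq: "p (q z) = z" and qp: "q (p x) = x" for z x
    by (simp_all add: p_def q_def vec_eq_iff forall_2)
  have blp: "bounded_linear p"
    unfolding linear_conv_bounded_linear[symmetric]
    by (rule linearI) (simp_all add: p_def complex_eq_iff)
  have blq: "bounded_linear q"
    unfolding linear_conv_bounded_linear[symmetric]
    by (rule linearI) (simp_all add: q_def vec_eq_iff forall_2)
  have norm_q: "norm (q z) = cmod z" for z
    by (simp add: norm_vec_def L2_set_def sum_2 q_def cmod_def)
  have pS: "p x \<in> box (Complex a c) (Complex b d) \<longleftrightarrow> x \<in> S" for x
    by (simp add: S_def mem_box_cart q_def p_def in_box_complex_iff forall_2)
  have pcS: "p x \<in> cbox (Complex a c) (Complex b d) \<longleftrightarrow> x \<in> cbox (q (Complex a c)) (q (Complex b d))" for x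
    by (simp add: mem_box_cart q_def p_def in_cbox_complex_iff forall_2)
  have det: "\<bar>det (matrix (g' x))\<bar> = J (p x)" for x
  proof -
    have pa: "p (axis 1 1) = 1" "p (axis 2 1) = \<i>"
      by (simp_all add: p_def complex_eq_iff axis_def)
    have "det (matrix (g' x)) = (cmod (\<alpha> (p x)))\<^sup>2 - (cmod (\<beta> (p x)))\<^sup>2"
      unfolding cmod_power2
      by (simp add: det_2 matrix_def g'_def pa q_def algebra_simps power2_eq_square)
    then show ?thesis by (simp add: J_def)
  qed
  have contJ: "continuous_on (cbox (Complex a c) (Complex b d)) J"
    unfolding J_def by (intro continuous_intros cont)
  have cont_p: "continuous_on T p" for T
    using blp by (rule linear_continuous_on)
  have contJp: "continuous_on (cbox (q (Complex a c)) (q (Complex b d))) (\<lambda>x. J (p x))"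
    by (rule continuous_on_compose2[OF contJ cont_p]) (auto simp: pcS)
  have derg: "((q \<circ> G \<circ> p) has_derivative g' x) (at x within S)" if "x \<in> S" for x
  proof -
    have "(q \<circ> G \<circ> p has_derivative q \<circ> (\<lambda>v. \<alpha> (p x) * v + \<beta> (p x) * cnj v) \<circ> p) (at x)"
      by (intro diff_chain_at bounded_linear_imp_has_derivative blp blq der) (simp add: pS that)
    then show ?thesis
      by (simp add: g'_def o_def has_derivative_at_withinI)
  qed
  have injg: "inj_on (q \<circ> G \<circ> p) S"
  proof (rule inj_onI)
    fix x y assume xy: "x \<in> S" "y \<in> S" "(q \<circ> G \<circ> p) x = (q \<circ> G \<circ> p) y"
    then have "G (p x) = G (p y)" by (metis comp_apply pq)
    then have "p x = p y" using inj_onD[OF inj] xy pS by blast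
    then show "x = y" by (metis qp)
  qed
  have intJ: "(\<lambda>x. J (p x)) integrable_on S"
    unfolding S_def using integrable_continuous[OF contJp] by (simp add: integrable_on_open_interval)
  have lm: "(q \<circ> G \<circ> p) ` S \<in> lmeasurable"
    using measurable_differentiable_image_eq[of S "q \<circ> G \<circ> p" g'] derg injg intJ
    by (simp add: det S_def)
  have "measure lebesgue ((q \<circ> G \<circ> p) ` S) = integral S (\<lambda>x. J (p x))"
    using measure_differentiable_image_eq[of S "q \<circ> G \<circ> p" g'] derg injg intJ
    by (simp add: det S_def)
  moreover have "(q \<circ> G \<circ> p) ` S \<subseteq> cball 0 R"
    using sub by (auto simp: norm_q image_subset_iff pS dist_norm)
  then have "measure lebesgue ((q \<circ> G \<circ> p) ` S) \<le> measure lebesgue (cball (0::real^2) R)"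
    using lm by (intro measure_mono_fmeasurable) auto
  moreover have "measure lebesgue (cball (0::real^2) R) = pi * R\<^sup>2"
    using R content_cball[of R "0::real^2"] by (simp add: eval_unit_ball_vol)
  moreover have "integral S (\<lambda>x. J (p x)) = integral (cbox (q (Complex a c)) (q (Complex b d))) (\<lambda>x. J (p x))"
    by (simp add: S_def integral_open_interval)
  moreover have "integral (cbox (q (Complex a c)) (q (Complex b d))) (\<lambda>x. J (p x)) =
      integral {a..b} (\<lambda>s. integral {c..d} (\<lambda>t. J (Complex s t)))"
  proof -
    \<comment> \<open>A second transport, from \<open>real^2\<close> to
      \<open>real \<times> real\<close>, makes Fubini's theorem applicable; boxes go to boxes of
      equal content, so the scaling factor is 1.\<close>
    define u :: "real^2 \<Rightarrow> real \<times> real" where "u = (\<lambda>x. (vec_nth x 1, vec_nth x 2))"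
    define v :: "real \<times> real \<Rightarrow> real^2" where "v = (\<lambda>y. vector [fst y, snd y])"
    define K where "K = (\<lambda>y. J (Complex (fst y) (snd y)))"
    have u: "u ` cbox x y = cbox (u x) (u y)" for x y
    proof -
      have "(s, t) \<in> u ` cbox x y" if "(s, t) \<in> cbox (u x) (u y)" for s t
        by (rule image_eqI[of _ _ "vector [s, t]"])
          (use that in \<open>auto simp: u_def mem_box_cart forall_2 cbox_Pair_eq\<close>)
      then show ?thesis by (auto simp: u_def mem_box_cart cbox_Pair_eq)
    qed
    have uv: "u (v y) = y" and vu: "v (u x) = x" for x y
      by (simp_all add: u_def v_def vec_eq_iff forall_2)
    have v: "v ` cbox x y = cbox (v x) (v y)" for x y
    proof -
      have "cbox x y = u ` cbox (v x) (v y)" by (simp only: u uv)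
      then show ?thesis by (simp only: image_image vu image_ident)
    qed
    have contK: "continuous_on (cbox (a, c) (b, d)) K"
      unfolding K_def by (rule continuous_on_compose2[OF contJ])
        (auto intro!: continuous_intros simp: cbox_Pair_eq in_cbox_complex_iff Complex_eq)
    have "(K has_integral integral (cbox (a, c) (b, d)) K) (cbox (a, c) (b, d))"
      using contK by (intro integrable_integral integrable_continuous)
    moreover have "measure lborel (u ` cbox x y) = 1 * measure lborel (cbox x y)" for x y
    proof -
      have ex2: "(\<exists>i::2. P i) \<longleftrightarrow> P 1 \<or> P 2" for P
        by (metis exhaust_2)
      have "measure lborel (u ` cbox x y) = measure lborel (cbox (vec_nth x 1) (vec_nth y 1)) * measure lborel (cbox (vec_nth x 2) (vec_nth y 2))"
        unfolding u by (simp add: u_def content_Pair)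
      also have "\<dots> = measure lborel (cbox x y)"
        unfolding content_cbox_if_cart
        by (auto simp: content_real_if interval_eq_empty_cart(1) cbox_interval UNIV_2 ex2 less_eq_vec_def forall_2)
      finally show ?thesis by simp
    qed
    ultimately have "((\<lambda>x. K (u x)) has_integral (1 / 1) *\<^sub>R integral (cbox (a, c) (b, d)) K) (v ` cbox (a, c) (b, d))"
      by (intro has_integral_twiddle uv vu)
         (use u v in \<open>auto simp: u_def intro!: continuous_intros\<close>)
    then have "integral (v ` cbox (a, c) (b, d)) (\<lambda>x. K (u x)) = integral (cbox (a, c) (b, d)) K"
      by (simp add: integral_unique)
    moreover have "v ` cbox (a, c) (b, d) = cbox (q (Complex a c)) (q (Complex b d))"
      unfolding v by (simp add: v_def q_def)
    moreover have "(\<lambda>x. K (u x)) = (\<lambda>x. J (p x))"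
      by (simp add: K_def u_def p_def)
    ultimately show ?thesis
      using integral_prod_continuous[OF contK] by (simp add: K_def cbox_interval)
  qed
  ultimately show ?thesis unfolding J_def by linarith
qed

subsection \<open>Bessel's inequality on circles\<close>

text \<open>This is Cauchy's formula for the n-th derivative, rewritten as a Fourier coefficient: on
  the circle of radius \<open>\<rho>\<close>, \<open>cnj (z ^ n)\<close> equals
  \<open>\<rho> ^ (2 * n) / z ^ n\<close>.\<close>

lemma fps_coeff_has_integral_circle:
  fixes k :: "complex \<Rightarrow> complex" and \<rho> :: real
  assumes k: "k holomorphic_on ball 0 1" and \<rho>: "0 < \<rho>" "\<rho> < 1"
  shows "((\<lambda>t. k (\<rho> * cis t) * cnj ((\<rho> * cis t) ^ n)) has_integral
          2 * pi * fps_nth (fps_expansion k 0) n * \<rho> ^ (2 * n)) {0..2 * pi}"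
proof -
  have "((\<lambda>u. k u / (u - 0) ^ Suc n) has_contour_integral (complex_of_real (2 * pi) * \<i>) / fact n * (deriv ^^ n) k 0)
          (circlepath 0 \<rho>)"
    using \<rho> by (intro Cauchy_has_contour_integral_higher_derivative_circlepath)
      (auto intro!: holomorphic_on_imp_continuous_on holomorphic_on_subset[OF k])
  then have "((\<lambda>t. k (\<rho> * cis t) / (\<rho> * cis t) ^ Suc n * \<rho> * \<i> * cis t) has_integral
          (complex_of_real (2 * pi) * \<i>) / fact n * (deriv ^^ n) k 0) {0..2 * pi}"
    unfolding circlepath_def by (subst (asm) has_contour_integral_part_circlepath_iff) auto
  \<comment> \<open>The factor -i removes the i coming from dz = i z dt, and
    \<open>\<rho> ^ (2 * n)\<close> turns 1 / z^n into the conjugate power.\<close>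
  from has_integral_mult_right[OF this, of "- \<i> * \<rho> ^ (2 * n)"]
  have "((\<lambda>t. - \<i> * \<rho> ^ (2 * n) * (k (\<rho> * cis t) / (\<rho> * cis t) ^ Suc n * \<rho> * \<i> * cis t)) has_integral
          2 * pi * fps_nth (fps_expansion k 0) n * \<rho> ^ (2 * n)) {0..2 * pi}"
    by (simp add: fps_expansion_def mult_ac)
  moreover have "- \<i> * \<rho> ^ (2 * n) * (k (\<rho> * cis t) / (\<rho> * cis t) ^ Suc n * \<rho> * \<i> * cis t) =
      k (\<rho> * cis t) * cnj ((\<rho> * cis t) ^ n)" for t
  proof -
    have nz: "cis t \<noteq> 0" by simp
    have "(\<rho> * cis t) * cnj (\<rho> * cis t) = complex_of_real \<rho> ^ 2"
      unfolding complex_norm_square[symmetric] by (simp add: norm_mult power2_abs flip: of_real_power)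
    then have "(\<rho> * cis t) ^ n * cnj ((\<rho> * cis t) ^ n) = complex_of_real \<rho> ^ (2 * n)"
      by (metis complex_cnj_power power_mult power_mult_distrib)
    then have "cnj ((\<rho> * cis t) ^ n) = complex_of_real \<rho> ^ (2 * n) / (\<rho> * cis t) ^ n"
      using \<rho> nz by (simp add: field_simps)
    then show ?thesis using \<rho> nz by (simp add: field_simps)
  qed
  ultimately show ?thesis by simp
qed

text \<open>With \<open>p\<close> the Taylor polynomial of degree at most \<open>N\<close>, both the
  mean of Re (k cnj p) and that of |p|^2 equal the partial sum; expanding 0 <= |k - p|^2 then bounds
  that sum by the mean of |k|^2.\<close>

lemma bessel_circle:
  fixes k :: "complex \<Rightarrow> complex" and \<rho> :: real
  assumes k: "k holomorphic_on ball 0 1" and \<rho>: "0 < \<rho>" "\<rho> < 1"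
  shows "2 * pi * (\<Sum>n\<le>N. (cmod (fps_nth (fps_expansion k 0) n))\<^sup>2 * \<rho> ^ (2 * n))
         \<le> integral {0..2 * pi} (\<lambda>t. (cmod (k (\<rho> * cis t)))\<^sup>2)"
proof -
  define c where "c = fps_nth (fps_expansion k 0)"
  define S where "S = (\<Sum>n\<le>N. (cmod (c n))\<^sup>2 * \<rho> ^ (2 * n))"
  define p where "p = (\<lambda>z. \<Sum>n\<le>N. c n * z ^ n)"
  \<comment> \<open>Only the coefficients of index at most \<open>N\<close> matter, so one
    computation serves both f = k and f = p.\<close>
  have int: "((\<lambda>t. Re (f (\<rho> * cis t) * cnj (p (\<rho> * cis t)))) has_integral 2 * pi * S) {0..2 * pi}"
    if f: "f holomorphic_on ball 0 1" and fc: "\<And>n. n \<le> N \<Longrightarrow> fps_nth (fps_expansion f 0) n = c n" for f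
  proof -
    have "((\<lambda>t. \<Sum>n\<le>N. f (\<rho> * cis t) * cnj ((\<rho> * cis t) ^ n) * cnj (c n)) has_integral
           (\<Sum>n\<le>N. 2 * pi * fps_nth (fps_expansion f 0) n * \<rho> ^ (2 * n) * cnj (c n))) {0..2 * pi}"
      by (intro has_integral_sum has_integral_mult_left fps_coeff_has_integral_circle f \<rho>) auto
    moreover have "(\<Sum>n\<le>N. 2 * pi * fps_nth (fps_expansion f 0) n * \<rho> ^ (2 * n) * cnj (c n)) = complex_of_real (2 * pi * S)"
    proof -
      have eq: "2 * pi * c n * \<rho> ^ (2 * n) * cnj (c n) =
            complex_of_real (2 * pi * ((cmod (c n))\<^sup>2 * \<rho> ^ (2 * n)))" for n
        by (simp add: mult_ac flip: complex_norm_square)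
      show ?thesis
        unfolding S_def sum_distrib_left of_real_sum
        by (rule sum.cong) (simp_all only: fc atMost_iff eq)
    qed
    moreover have "(\<lambda>t. \<Sum>n\<le>N. f (\<rho> * cis t) * cnj ((\<rho> * cis t) ^ n) * cnj (c n)) =
       (\<lambda>t. f (\<rho> * cis t) * cnj (p (\<rho> * cis t)))"
      by (simp add: p_def sum_distrib_left mult_ac)
    ultimately have "((\<lambda>t. f (\<rho> * cis t) * cnj (p (\<rho> * cis t))) has_integral complex_of_real (2 * pi * S)) {0..2 * pi}"
      by simp
    from has_integral_linear[OF this bounded_linear_Re] show ?thesis by (simp add: o_def)
  qed
  have hp: "p holomorphic_on ball 0 1" unfolding p_def by (intro holomorphic_intros)
  have cp: "fps_nth (fps_expansion p 0) n = c n" if "n \<le> N" for n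
  proof -
    have "p has_fps_expansion (\<Sum>n\<le>N. fps_const (c n) * fps_X ^ n)"
      unfolding p_def by (intro fps_expansion_intros)
    then have "fps_expansion p 0 = (\<Sum>n\<le>N. fps_const (c n) * fps_X ^ n)"
      by (rule fps_expansion_eqI)
    then show ?thesis using that by (simp add: fps_sum_nth fps_X_power_nth if_distrib cong: if_cong)
  qed
  have ik: "((\<lambda>t. Re (k (\<rho> * cis t) * cnj (p (\<rho> * cis t)))) has_integral 2 * pi * S) {0..2 * pi}"
    by (rule int[OF k]) (simp add: c_def)
  have ip: "((\<lambda>t. Re (p (\<rho> * cis t) * cnj (p (\<rho> * cis t)))) has_integral 2 * pi * S) {0..2 * pi}"
    by (rule int[OF hp cp])
  have "((\<lambda>t. 2 * Re (k (\<rho> * cis t) * cnj (p (\<rho> * cis t))) - Re (p (\<rho> * cis t) * cnj (p (\<rho> * cis t))))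
      has_integral 2 * (2 * pi * S) - 2 * pi * S) {0..2 * pi}"
    by (intro has_integral_diff has_integral_mult_right ik ip)
  moreover have "(\<lambda>t. (cmod (k (\<rho> * cis t)))\<^sup>2) integrable_on {0..2 * pi}"
    using \<rho> by (intro integrable_continuous_real continuous_intros
        continuous_on_compose2[OF holomorphic_on_imp_continuous_on[OF k]]) (auto simp: norm_mult)
  then have "((\<lambda>t. (cmod (k (\<rho> * cis t)))\<^sup>2) has_integral
      integral {0..2 * pi} (\<lambda>t. (cmod (k (\<rho> * cis t)))\<^sup>2)) {0..2 * pi}"
    by (rule integrable_integral)
  moreover have "2 * Re (x * cnj y) - Re (y * cnj y) \<le> (cmod x)\<^sup>2" for x y
  proof -
    have "0 \<le> (cmod (x - y))\<^sup>2" by simp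
    then show ?thesis unfolding cmod_power2 by (simp add: power2_eq_square algebra_simps)
  qed
  ultimately have "2 * (2 * pi * S) - 2 * pi * S \<le> integral {0..2 * pi} (\<lambda>t. (cmod (k (\<rho> * cis t)))\<^sup>2)"
    by (rule has_integral_le)
  then show ?thesis by (simp add: S_def c_def)
qed

subsection \<open>The area theorem\<close>

text \<open>
  The image of the punctured disk of radius \<open>\<epsilon>\<close> is open, and relatively closed in the connected set
  \<open>- C\<close>; so it covers \<open>- C\<close>, and injectivity leaves only \<open>C\<close> for the rest.
\<close>

lemma image_annulus_subset_convex:
  fixes h :: "complex \<Rightarrow> complex"
  assumes h: "h holomorphic_on ball 0 1 - {0}" and inj: "inj_on h (ball 0 1 - {0})"
    and pole: "filterlim h at_infinity (at 0)" and \<epsilon>: "0 < \<epsilon>" "\<epsilon> < 1"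
    and C: "bounded C" "convex C" and sub: "h ` sphere 0 \<epsilon> \<subseteq> C"
  shows "h ` (ball 0 1 - cball 0 \<epsilon>) \<subseteq> C"
proof -
  define T where "T = h ` (ball 0 \<epsilon> - {0})"
  have cont: "continuous_on (ball 0 1 - {0}) h"
    using h by (rule holomorphic_on_imp_continuous_on)
  have far: "\<exists>\<delta>>0. \<forall>z. z \<noteq> 0 \<longrightarrow> cmod z < \<delta> \<longrightarrow> M < cmod (h z)" for M
  proof -
    have "eventually (\<lambda>z. M + 1 \<le> cmod (h z)) (at 0)"
      using filterlim_at_infinity[of "\<bar>M\<bar>" h "at 0"] pole
      by (metis eventually_at filterlim_at_infinity_imp_norm_at_top filterlim_at_top)
    then show ?thesis unfolding eventually_at
      by (force simp: dist_norm)
  qed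
  have "open T"
    unfolding T_def
  proof (rule open_mapping_thm3)
    show "h holomorphic_on ball 0 \<epsilon> - {0}" "inj_on h (ball 0 \<epsilon> - {0})"
      using \<epsilon> by (auto intro: holomorphic_on_subset[OF h] inj_on_subset[OF inj])
  qed auto
  have "closedin (top_of_set (- C)) (T \<inter> - C)"
    unfolding closedin_limpt
  proof (intro conjI allI impI)
    \<comment> \<open>A bounded sequence of values has its preimages bounded away from the pole, so
      the limit is attained on a compact annulus; modulus \<open>\<epsilon>\<close> is excluded
      since that circle is mapped into \<open>C\<close>.\<close>
    fix w assume w: "w islimpt (T \<inter> - C) \<and> w \<in> - C"
    then obtain X where X: "\<And>n. X n \<in> T" "X \<longlonglongrightarrow> w"
      unfolding islimpt_sequential by auto
    obtain M where M: "\<And>n. cmod (X n) \<le> M"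
      using convergent_imp_bounded[OF X(2)] by (auto simp: bounded_iff)
    obtain \<delta> where \<delta>: "\<delta> > 0" "\<And>z. z \<noteq> 0 \<Longrightarrow> cmod z < \<delta> \<Longrightarrow> M < cmod (h z)"
      using far by metis
    have "compact (h ` (cball 0 \<epsilon> - ball 0 \<delta>))"
      using \<epsilon> \<delta> by (intro compact_continuous_image continuous_on_subset[OF cont] compact_diff) auto
    moreover have "X n \<in> h ` (cball 0 \<epsilon> - ball 0 \<delta>)" for n
      using X(1)[of n] M[of n] \<delta>(2) by (fastforce simp: T_def)
    ultimately have "w \<in> h ` (cball 0 \<epsilon> - ball 0 \<delta>)"
      using closed_sequentially[OF compact_imp_closed] X(2) by blast
    then obtain z where z: "w = h z" "cmod z \<le> \<epsilon>" "cmod z \<ge> \<delta>" by auto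
    moreover have "cmod z \<noteq> \<epsilon>" using z(1) w sub by (auto simp: image_subset_iff)
    ultimately show "w \<in> T \<inter> - C" using w \<delta>(1) by (auto simp: T_def)
  qed auto
  moreover have "openin (top_of_set (- C)) (T \<inter> - C)"
    using \<open>open T\<close> by (metis Int_commute openin_open_Int)
  moreover have "connected (- C)"
    by (rule connected_complement_bounded_convex[OF C]) simp
  moreover have "T \<inter> - C \<noteq> {}"
  proof -
    obtain M where M: "\<And>w. w \<in> C \<Longrightarrow> cmod w \<le> M" using C by (auto simp: bounded_iff)
    obtain \<delta> where \<delta>: "\<delta> > 0" "\<And>z. z \<noteq> 0 \<Longrightarrow> cmod z < \<delta> \<Longrightarrow> M < cmod (h z)"
      using far by metis
    have "h (complex_of_real (min \<delta> \<epsilon> / 2)) \<in> T \<inter> - C"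
      using M[of "h (complex_of_real (min \<delta> \<epsilon> / 2))"] \<delta>(2)[of "complex_of_real (min \<delta> \<epsilon> / 2)"] \<delta>(1) \<epsilon>
      by (force simp: T_def simp del: of_real_divide)
    then show ?thesis by blast
  qed
  ultimately have *: "- C \<subseteq> T"
    unfolding connected_clopen by blast
  show ?thesis
  proof
    fix w assume "w \<in> h ` (ball 0 1 - cball 0 \<epsilon>)"
    then obtain z where z: "w = h z" "cmod z < 1" "\<epsilon> < cmod z" by auto
    show "w \<in> C"
    proof (rule ccontr)
      assume "w \<notin> C"
      then obtain z' where z': "w = h z'" "z' \<noteq> 0" "cmod z' < \<epsilon>" using * by (force simp: T_def)
      have "z \<noteq> 0" using z \<epsilon> by auto
      then have "z = z'" using inj_onD[OF inj, of z z'] z z' \<epsilon> by auto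
      then show False using z z' by simp
    qed
  qed
qed

text \<open>For h = k / z, the function z k' - k is z^2 h'. Its coefficients are those needed to
  estimate the integral of |h'|^2, and the factor n - 1 kills the constant term of h.\<close>

lemma fps_expansion_Euler_minus:
  assumes k: "k holomorphic_on ball 0 1"
  shows "fps_nth (fps_expansion (\<lambda>z. z * deriv k z - k z) 0) n
         = (of_nat n - 1) * fps_nth (fps_expansion k 0) n"
proof -
  have "k has_fps_expansion fps_expansion k 0"
    using k by (intro has_fps_expansion_fps_expansion[of "ball 0 1"]) auto
  then have "(\<lambda>z. z * deriv k z - k z) has_fps_expansion
      fps_X * fps_deriv (fps_expansion k 0) - fps_expansion k 0"
    by (intro fps_expansion_intros has_fps_expansion_deriv)
  then have eq: "fps_expansion (\<lambda>z. z * deriv k z - k z) 0 =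
      fps_X * fps_deriv (fps_expansion k 0) - fps_expansion k 0"
    by (rule fps_expansion_eqI)
  show ?thesis
    unfolding eq by (cases n) (simp_all add: algebra_simps)
qed

text \<open>Since h = k / z has the expansion 1/z + c_1 + c_2 z + ..., term-by-term integration of
  |h'|^2 over the annulus, truncated by Bessel's inequality, gives pi times the difference of the
  values of T(\<rho>) - 1/\<rho>^2 at \<open>r\<close> and \<open>\<epsilon>\<close>. The map
  \<open>w \<mapsto> w - \<mu> * cnj w\<close> multiplies areas by 1 - |\<mu>|^2, and the image of
  the annulus stays in a disk of radius \<open>R\<close>.\<close>

lemma area_inequality_annulus:
  fixes k :: "complex \<Rightarrow> complex" and \<epsilon> r R :: real and N :: nat
  defines "c \<equiv> fps_nth (fps_expansion k 0)"
  defines "T \<equiv> (\<lambda>\<rho>::real. \<Sum>n=1..N. real n * (cmod (c (Suc n)))\<^sup>2 * \<rho> ^ (2 * n))"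
  assumes k: "k holomorphic_on ball 0 1" and k0: "k 0 = 1"
    and inj: "inj_on (\<lambda>z. k z / z) (ball 0 1 - {0})"
    and \<epsilon>: "0 < \<epsilon>" "\<epsilon> < r" and r: "r < 1" and l: "cmod \<mu> < 1"
    and bd: "\<And>z. cmod z = \<epsilon> \<Longrightarrow> cmod ((k z / z - w0) - \<mu> * cnj (k z / z - w0)) \<le> R"
  shows "(1 - (cmod \<mu>)\<^sup>2) * ((T r - 1 / r\<^sup>2) - (T \<epsilon> - 1 / \<epsilon>\<^sup>2)) \<le> R\<^sup>2"
proof -
  define h where "h = (\<lambda>z. k z / z)"
  define M where "M = (\<lambda>w. w - \<mu> * cnj w)"
  \<comment> \<open>\<open>C\<close> is bounded by an ellipse, the preimage of a circle. The
    topological lemma can thus be applied to the holomorphic \<open>h\<close> itself and not to its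
    composition with \<open>M\<close>.\<close>
  define C where "C = M -` cball (M w0) R"
  define \<kappa> where "\<kappa> = (\<lambda>z. z * deriv k z - k z)"
  \<comment> \<open>In the coordinate z = exp \<zeta> this is the derivative of h (exp \<zeta>),
    namely z h'(z).\<close>
  define \<alpha> where "\<alpha> = (\<lambda>\<zeta>. \<kappa> (exp \<zeta>) / exp \<zeta>)"
  define G where "G = (\<lambda>\<zeta>. M (h (exp \<zeta>)) - M w0)"
  \<comment> \<open>\<open>exp\<close> maps this open rectangle injectively onto the annulus without
    its positive real segment. The lost segment has no area.\<close>
  define B where "B = box (Complex (ln \<epsilon>) 0) (Complex (ln r) (2 * pi))"
  have r0: "0 < r" using \<epsilon> by simp
  have lnlt: "ln \<epsilon> < ln r" using \<epsilon> by simp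
  have blM: "bounded_linear M"
    unfolding M_def by (intro bounded_linear_intros bounded_linear_cnj)
  have Mdiff: "M x - M y = (x - y) - \<mu> * cnj (x - y)" for x y
    by (simp add: M_def algebra_simps)
  have Mlow: "(1 - cmod \<mu>) * cmod w \<le> cmod (M w)" for w
    using norm_triangle_ineq2[of w "\<mu> * cnj w"] by (simp add: M_def norm_mult algebra_simps)
  have "0 \<le> R"
    using bd[of "complex_of_real \<epsilon>"] \<epsilon> norm_ge_zero order_trans by (metis norm_of_real abs_of_pos)
  have "convex C"
    unfolding C_def using blM by (intro convex_linear_vimage bounded_linear.linear) auto
  moreover have "bounded C"
  proof -
    have "cmod w \<le> (R + cmod (M w0)) / (1 - cmod \<mu>)" if "w \<in> C" for w
    proof -
      have "cmod (M w) \<le> R + cmod (M w0)"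
        using that norm_triangle_ineq2[of "M w" "M w0"] by (auto simp: C_def dist_norm norm_minus_commute)
      then show ?thesis using Mlow[of w] l by (simp add: field_simps)
    qed
    then show ?thesis by (auto simp: bounded_iff)
  qed
  moreover have "h ` sphere 0 \<epsilon> \<subseteq> C"
  proof -
    have "cmod (M (h z) - M w0) \<le> R" if "cmod z = \<epsilon>" for z
      unfolding Mdiff using bd[OF that] by (simp add: h_def)
    then show ?thesis by (auto simp: C_def dist_norm norm_minus_commute)
  qed
  moreover have "filterlim h at_infinity (at 0)"
  proof -
    have "isCont k 0"
      using holomorphic_on_imp_continuous_on[OF k] by (simp add: continuous_on_eq_continuous_at)
    then have "(k \<longlongrightarrow> 1) (at 0)" by (simp add: isCont_def k0)
    then show ?thesis
      unfolding h_def by (intro filterlim_divide_at_infinity[of _ 1]) (auto simp: filterlim_at eventually_at_filter)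
  qed
  ultimately have sub: "h ` (ball 0 1 - cball 0 \<epsilon>) \<subseteq> C"
    using \<epsilon> r inj by (intro image_annulus_subset_convex)
      (auto simp: h_def intro!: holomorphic_intros holomorphic_on_subset[OF k])
  have ann: "\<epsilon> < cmod (exp \<zeta>)" "cmod (exp \<zeta>) < r" if "\<zeta> \<in> B" for \<zeta>
  proof -
    have "ln \<epsilon> < Re \<zeta>" "Re \<zeta> < ln r" using that by (auto simp: B_def in_box_complex_iff)
    then show "\<epsilon> < cmod (exp \<zeta>)" "cmod (exp \<zeta>) < r"
      using \<epsilon> r0 by (metis exp_less_cancel_iff exp_ln norm_exp_eq_Re)+
  qed
  have area: "integral {ln \<epsilon>..ln r} (\<lambda>s. integral {0..2 * pi}
           (\<lambda>t. \<bar>(cmod (\<alpha> (Complex s t)))\<^sup>2 - (cmod (- \<mu> * cnj (\<alpha> (Complex s t))))\<^sup>2\<bar>)) \<le> pi * R\<^sup>2"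
  proof (rule area_image_le[of "ln \<epsilon>" 0 "ln r" "2 * pi" G \<alpha>  "\<lambda>\<zeta>. - \<mu> * cnj (\<alpha> \<zeta>)", folded B_def])
    fix \<zeta> assume \<zeta>: "\<zeta> \<in> B"
    have "(k has_field_derivative deriv k (exp \<zeta>)) (at (exp \<zeta>))"
      using ann[OF \<zeta>] r by (intro holomorphic_derivI[OF k]) (auto simp del: norm_exp_eq_Re)
    then have "((\<lambda>\<zeta>. h (exp \<zeta>)) has_field_derivative \<alpha> \<zeta>) (at \<zeta>)"
      unfolding h_def \<alpha>_def \<kappa>_def
      by (auto intro!: derivative_eq_intros DERIV_chain2[of k] simp: field_simps power2_eq_square)
    then have "((\<lambda>\<zeta>. h (exp \<zeta>)) has_derivative (\<lambda>v. \<alpha> \<zeta> * v)) (at \<zeta>)"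
      by (simp add: has_field_derivative_def)
    then have "((\<lambda>\<zeta>. M (h (exp \<zeta>))) has_derivative (\<lambda>v. M (\<alpha> \<zeta> * v))) (at \<zeta>)"
      by (rule bounded_linear.has_derivative[OF blM])
    then have "(G has_derivative (\<lambda>v. M (\<alpha> \<zeta> * v) - 0)) (at \<zeta>)"
      unfolding G_def by (intro has_derivative_diff has_derivative_const)
    then show "(G has_derivative (\<lambda>v. \<alpha> \<zeta> * v + - \<mu> * cnj (\<alpha> \<zeta>) * cnj v)) (at \<zeta>)"
      by (simp add: M_def mult_ac)
  next
    show "inj_on G B"
    proof (rule inj_onI)
      fix x y assume xy: "x \<in> B" "y \<in> B" "G x = G y"
      have "M (h (exp x) - h (exp y)) = 0"
        using xy by (simp add: G_def linear_diff[OF bounded_linear.linear[OF blM]])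
      then have "h (exp x) = h (exp y)"
        using Mlow[of "h (exp x) - h (exp y)"] l by (simp add: mult_le_0_iff)
      then have eq: "exp x = exp y"
        using inj_onD[OF inj, of "exp x" "exp y"] ann[OF xy(1)] ann[OF xy(2)] r
        by (simp add: h_def del: norm_exp_eq_Re)
      show "x = y"
        by (rule exp_complex_eqI[OF _ eq]) (use xy(1,2) in \<open>auto simp: B_def in_box_complex_iff\<close>)
    qed
  next
    have "cmod (G \<zeta>) \<le> R" if "\<zeta> \<in> B" for \<zeta>
    proof -
      have "exp \<zeta> \<in> ball 0 1 - cball 0 \<epsilon>"
        using ann[OF that] r by (simp del: norm_exp_eq_Re)
      then have "h (exp \<zeta>) \<in> C" using sub by blast
      then show ?thesis by (simp add: C_def G_def dist_norm norm_minus_commute)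
    qed
    then show "G ` B \<subseteq> cball 0 R" by auto
  next
    show cont\<alpha>: "continuous_on (cbox (Complex (ln \<epsilon>) 0) (Complex (ln r) (2 * pi))) \<alpha>"
    proof -
      have "exp ` cbox (Complex (ln \<epsilon>) 0) (Complex (ln r) (2 * pi)) \<subseteq> ball (0::complex) 1"
      proof (clarsimp simp: in_cbox_complex_iff)
        fix \<zeta> assume "Re \<zeta> \<le> ln r"
        then show "Re \<zeta> < 0" using ln_less_zero[OF r0 r] by linarith
      qed
      then show ?thesis
        unfolding \<alpha>_def \<kappa>_def
        by (intro continuous_intros continuous_on_compose2[OF holomorphic_on_imp_continuous_on[OF k]]
            continuous_on_compose2[OF holomorphic_on_imp_continuous_on[OF holomorphic_deriv[OF k]]]) auto
    qed
    then show "continuous_on (cbox (Complex (ln \<epsilon>) 0) (Complex (ln r) (2 * pi))) (\<lambda>\<zeta>. - \<mu> * cnj (\<alpha> \<zeta>))"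
      by (intro continuous_intros)
  qed fact
  \<comment> \<open>\<open>I\<close> is the integral over the circle of radius exp s,
    \<open>P\<close> is its Bessel lower bound divided by 2 pi, and \<open>A\<close> is a primitive
    of \<open>P\<close>. In \<open>P\<close> the index 0 contributes exp (-2 s) and the index 1
    vanishes; \<open>A\<close> shifts the remaining indices down by one.\<close>
  define I where "I = (\<lambda>s::real. integral {0..2 * pi} (\<lambda>t. (cmod (\<kappa> (complex_of_real (exp s) * cis t)))\<^sup>2 / (exp s)\<^sup>2))"
  define P where "P = (\<lambda>s::real. \<Sum>n\<le>Suc N. (cmod ((of_nat n - 1) * c n))\<^sup>2 * exp s ^ (2 * n) / (exp s)\<^sup>2)"
  define A where "A = (\<lambda>s::real. (\<Sum>n=1..N. real n / 2 * (cmod (c (Suc n)))\<^sup>2 * exp (2 * n * s)) - exp (- 2 * s) / 2)"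
  have neg: "s < 0" if "s \<le> ln r" for s
    using that ln_less_zero[OF r0 r] by linarith
  have kappa_hol: "\<kappa> holomorphic_on ball 0 1"
    unfolding \<kappa>_def by (intro holomorphic_intros k) auto
  have c_kappa: "fps_nth (fps_expansion \<kappa> 0) n = (of_nat n - 1) * c n" for n
    unfolding \<kappa>_def c_def by (rule fps_expansion_Euler_minus[OF k])
  have PI: "2 * pi * P s \<le> I s" if "s \<le> ln r" for s
  proof -
    have "2 * pi * (\<Sum>n\<le>Suc N. (cmod ((of_nat n - 1) * c n))\<^sup>2 * exp s ^ (2 * n)) \<le>
          integral {0..2 * pi} (\<lambda>t. (cmod (\<kappa> (complex_of_real (exp s) * cis t)))\<^sup>2)"
      using bessel_circle[OF kappa_hol, of "exp s" "Suc N"] neg[OF that] by (simp only: c_kappa exp_gt_zero exp_less_one_iff)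
    then have "2 * pi * (\<Sum>n\<le>Suc N. (cmod ((of_nat n - 1) * c n))\<^sup>2 * exp s ^ (2 * n)) / (exp s)\<^sup>2 \<le>
          integral {0..2 * pi} (\<lambda>t. (cmod (\<kappa> (complex_of_real (exp s) * cis t)))\<^sup>2) / (exp s)\<^sup>2"
      by (rule divide_right_mono) simp
    then show ?thesis
      by (simp only: P_def I_def sum_divide_distrib[symmetric] times_divide_eq_right integral_divide)
  qed
  have I_eq: "integral {0..2 * pi} (\<lambda>t. \<bar>(cmod (\<alpha> (Complex s t)))\<^sup>2 - (cmod (- \<mu> * cnj (\<alpha> (Complex s t))))\<^sup>2\<bar>)
        = (1 - (cmod \<mu>)\<^sup>2) * I s" for s
  proof -
    have "\<bar>(cmod (\<alpha> (Complex s t)))\<^sup>2 - (cmod (- \<mu> * cnj (\<alpha> (Complex s t))))\<^sup>2\<bar> =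
          (1 - (cmod \<mu>)\<^sup>2) * ((cmod (\<kappa> (complex_of_real (exp s) * cis t)))\<^sup>2 / (exp s)\<^sup>2)" for t
    proof -
      have "exp (Complex s t) = complex_of_real (exp s) * cis t"
        by (simp add: exp_eq_polar)
      then have "(cmod (\<alpha> (Complex s t)))\<^sup>2 = (cmod (\<kappa> (complex_of_real (exp s) * cis t)))\<^sup>2 / (exp s)\<^sup>2"
        by (simp add: \<alpha>_def norm_divide norm_mult power_divide)
      moreover have "(cmod \<mu>)\<^sup>2 \<le> 1" using l by (simp add: power_le_one)
      moreover have "(cmod (\<alpha> (Complex s t)))\<^sup>2 - (cmod (- \<mu> * cnj (\<alpha> (Complex s t))))\<^sup>2 =
          (1 - (cmod \<mu>)\<^sup>2) * (cmod (\<alpha> (Complex s t)))\<^sup>2"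
        by (simp add: norm_mult power_mult_distrib algebra_simps)
      ultimately show ?thesis by simp
    qed
    then show ?thesis by (simp add: I_def)
  qed
  have "continuous_on (cbox (ln \<epsilon>, 0) (ln r, 2 * pi))
          (\<lambda>(s, t). (cmod (\<kappa> (complex_of_real (exp s) * cis t)))\<^sup>2 / (exp s)\<^sup>2)"
    unfolding case_prod_unfold
    by (intro continuous_intros continuous_on_compose2[OF holomorphic_on_imp_continuous_on[OF kappa_hol]])
       (auto simp: cbox_Pair_eq norm_mult neg)
  from integral_integrable_2dim[OF this]
  have I_int: "I integrable_on {ln \<epsilon>..ln r}"
    by (simp add: I_def cbox_interval)
  have P_eq: "P s = (\<Sum>n=1..N. (real n)\<^sup>2 * (cmod (c (Suc n)))\<^sup>2 * exp (2 * n * s)) + exp (- 2 * s)" for s :: real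
  proof -
    have c0: "c 0 = 1" by (simp add: c_def fps_expansion_def k0)
    have pow: "exp s ^ (2 * Suc n) / (exp s)\<^sup>2 = exp (2 * n * s)" for n
      using exp_of_nat_mult[of "2 * n" s] by (simp add: power2_eq_square)
    have inv: "1 / (exp s)\<^sup>2 = exp (- 2 * s)"
      by (simp add: exp_minus inverse_eq_divide exp_double)
    have "P s = 1 / (exp s)\<^sup>2 + (\<Sum>n\<le>N. (real n)\<^sup>2 * (cmod (c (Suc n)))\<^sup>2 * (exp s ^ (2 * Suc n) / (exp s)\<^sup>2))"
      unfolding P_def sum.atMost_Suc_shift by (simp add: c0 norm_mult power_mult_distrib)
    then have "P s = (\<Sum>n\<le>N. (real n)\<^sup>2 * (cmod (c (Suc n)))\<^sup>2 * exp (2 * n * s)) + exp (- 2 * s)"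
      unfolding pow inv by simp
    also have "(\<Sum>n\<le>N. (real n)\<^sup>2 * (cmod (c (Suc n)))\<^sup>2 * exp (2 * n * s)) =
               (\<Sum>n=1..N. (real n)\<^sup>2 * (cmod (c (Suc n)))\<^sup>2 * exp (2 * n * s))"
      by (rule sum.mono_neutral_right) auto
    finally show ?thesis .
  qed
  have "(P has_integral (A (ln r) - A (ln \<epsilon>))) {ln \<epsilon>..ln r}"
  proof (rule fundamental_theorem_of_calculus)
    fix s
    have "(A has_field_derivative P s) (at s)"
      unfolding A_def P_eq
      by (auto intro!: derivative_eq_intros sum.cong simp: power2_eq_square)
    then show "(A has_vector_derivative P s) (at s within {ln \<epsilon>..ln r})"
      by (simp add: has_real_derivative_iff_has_vector_derivative has_vector_derivative_at_within)
  qed (use lnlt in simp)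
  then have "((\<lambda>s. (1 - (cmod \<mu>)\<^sup>2) * (2 * pi * P s)) has_integral
      (1 - (cmod \<mu>)\<^sup>2) * (2 * pi * (A (ln r) - A (ln \<epsilon>)))) {ln \<epsilon>..ln r}"
    by (intro has_integral_mult_right)
  moreover have "((\<lambda>s. (1 - (cmod \<mu>)\<^sup>2) * I s) has_integral
       integral {ln \<epsilon>..ln r} (\<lambda>s. (1 - (cmod \<mu>)\<^sup>2) * I s)) {ln \<epsilon>..ln r}"
    using I_int by (intro integrable_integral integrable_on_mult_right)
  moreover have "(1 - (cmod \<mu>)\<^sup>2) * (2 * pi * P s) \<le> (1 - (cmod \<mu>)\<^sup>2) * I s" if "s \<in> {ln \<epsilon>..ln r}" for s
    using PI[of s] that l by (intro mult_left_mono) (auto simp: power_le_one)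
  ultimately have "(1 - (cmod \<mu>)\<^sup>2) * (2 * pi * (A (ln r) - A (ln \<epsilon>))) \<le>
       integral {ln \<epsilon>..ln r} (\<lambda>s. (1 - (cmod \<mu>)\<^sup>2) * I s)"
    by (rule has_integral_le)
  also have "\<dots> \<le> pi * R\<^sup>2"
    using area by (simp only: I_eq)
  finally have "pi * ((1 - (cmod \<mu>)\<^sup>2) * (2 * (A (ln r) - A (ln \<epsilon>)))) \<le> pi * R\<^sup>2"
    by (simp add: mult_ac)
  then have "(1 - (cmod \<mu>)\<^sup>2) * (2 * (A (ln r) - A (ln \<epsilon>))) \<le> R\<^sup>2"
    by (simp only: mult_le_cancel_left_pos pi_gt_zero)
  then have "(1 - (cmod \<mu>)\<^sup>2) * (2 * A (ln r) - 2 * A (ln \<epsilon>)) \<le> R\<^sup>2"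
    by (simp only: right_diff_distrib[of 2])
  moreover have "2 * A (ln \<rho>) = T \<rho> - 1 / \<rho>\<^sup>2" if "0 < \<rho>" for \<rho>
  proof -
    have "exp (2 * n * ln \<rho>) = \<rho> ^ (2 * n)" for n
      using exp_of_nat_mult[of "2 * n" "ln \<rho>"] that by simp
    moreover have "exp (- 2 * ln \<rho>) = 1 / \<rho>\<^sup>2"
      using that by (simp add: exp_minus inverse_eq_divide exp_double)
    ultimately show ?thesis
      unfolding A_def T_def by (simp add: right_diff_distrib sum_distrib_left)
  qed
  ultimately show ?thesis using \<epsilon> r0 by simp
qed

text \<open>The coefficient of z^n in k / z is that of z^(n+1) in \<open>k\<close>, hence
  \<open>Suc n\<close>. In the annulus inequality with \<mu> = c_2 \<epsilon>^2, the divergent terms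
  1/\<epsilon>^2 cancel between the two sides, which leaves a bound for every r < 1.\<close>

theorem area_theorem:
  fixes k :: "complex \<Rightarrow> complex" and N :: nat
  assumes k: "k holomorphic_on ball 0 1" and k0: "k 0 = 1"
    and inj: "inj_on (\<lambda>z. k z / z) (ball 0 1 - {0})"
  shows "(\<Sum>n=1..N. real n * (cmod (fps_nth (fps_expansion k 0) (Suc n)))\<^sup>2) \<le> 1"
proof -
  define c where "c = fps_nth (fps_expansion k 0)"
  define T where "T = (\<lambda>\<rho>::real. \<Sum>n=1..N. real n * (cmod (c (Suc n)))\<^sup>2 * \<rho> ^ (2 * n))"
  define a where "a = cmod (c 2)"
  have c0: "c 0 = 1" by (simp add: c_def fps_expansion_def k0)
  have k_fps: "k has_fps_expansion fps_expansion k 0"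
    using k by (intro has_fps_expansion_fps_expansion[of "ball 0 1"]) auto
  define E where "E = fps_expansion k 0 - fps_const 1 - fps_const (c 1) * fps_X - fps_const (c 2) * fps_X ^ 2"
  have E: "(\<lambda>z. k z - 1 - c 1 * z - c 2 * z ^ 2) has_fps_expansion E"
    unfolding E_def by (intro fps_expansion_intros k_fps)
  obtain C where C: "\<forall>\<^sub>F z in at 0. cmod (k z - 1 - c 1 * z - c 2 * z ^ 2) \<le> C * cmod z ^ 3"
  \<comment> \<open>The zero series is treated apart because its \<open>subdegree\<close> is 0 by
    convention, so it could not be shifted by 3.\<close>
  proof (cases "E = 0")
    case True
    from E have "\<forall>\<^sub>F z in at 0. k z - 1 - c 1 * z - c 2 * z ^ 2 = 0"
      by (auto simp: True has_fps_expansion_def eventually_at_filter elim: eventually_mono)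
    then show ?thesis
      by (intro that[of 0]) (auto elim: eventually_mono)
  next
    case False
    have "fps_nth E i = 0" if "i < 3" for i
    proof -
      have "i = 0 \<or> i = 1 \<or> i = 2" using that by auto
      then show ?thesis using c0 by (auto simp: E_def c_def)
    qed
    then have "3 \<le> subdegree E" using False by (auto intro: subdegree_geI)
    from has_fps_expansion_imp_continuous[OF has_fps_expansion_shift[OF E this refl], of UNIV]
    have "isCont (\<lambda>z. if z = 0 then fps_nth E 3 else (k z - 1 - c 1 * z - c 2 * z ^ 2) / z ^ 3) 0" .
    then have "((\<lambda>z. if z = 0 then fps_nth E 3 else (k z - 1 - c 1 * z - c 2 * z ^ 2) / z ^ 3)
        \<longlongrightarrow> fps_nth E 3) (at 0)"
      by (simp add: isCont_def)
    then have "\<forall>\<^sub>F z in at 0. dist (if z = 0 then fps_nth E 3 else (k z - 1 - c 1 * z - c 2 * z ^ 2) / z ^ 3) (fps_nth E 3) < 1"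
      by (rule tendstoD) simp
    moreover have "\<forall>\<^sub>F z in at 0. z \<noteq> (0::complex)"
      by (simp add: eventually_at_filter)
    ultimately have "\<forall>\<^sub>F z in at 0. cmod (k z - 1 - c 1 * z - c 2 * z ^ 2) \<le> (cmod (fps_nth E 3) + 1) * cmod z ^ 3"
    proof eventually_elim
      case (elim z)
      then have "cmod ((k z - 1 - c 1 * z - c 2 * z ^ 2) / z ^ 3) \<le> cmod (fps_nth E 3) + 1"
        using norm_triangle_sub[of "(k z - 1 - c 1 * z - c 2 * z ^ 2) / z ^ 3" "fps_nth E 3"] by (simp add: dist_norm)
      then show ?case
        using elim by (simp add: norm_divide norm_power field_simps)
    qed
    then show ?thesis by (rule that)
  qed
  have step: "T r \<le> 1 / r\<^sup>2" if r: "0 < r" "r < 1" for r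
  proof -
    \<comment> \<open>The three summands bound, in units of \<epsilon>^2, the remainder
      \<open>e\<close>, the conjugate of the linear term after multiplication by \<mu>, and the
      conjugate of \<open>e\<close> after the same multiplication; \<epsilon> <= 1 is used for the
      last two.\<close>
    define C' where "C' = \<bar>C\<bar> + a\<^sup>2 + a * \<bar>C\<bar>"
    \<comment> \<open>This is the annulus inequality after cancelling 1/\<epsilon>^2; the term in
      a^2 is what remains of |\<mu>|^2 / \<epsilon>^2. The right-hand side tends to 0.\<close>
    have "\<forall>\<^sub>F \<epsilon> in at_right 0. (1 - (a * \<epsilon>\<^sup>2)\<^sup>2) * ((T r - 1 / r\<^sup>2) - T \<epsilon>) \<le>
            a\<^sup>2 * \<epsilon>\<^sup>2 + 2 * C' * \<epsilon> + C'\<^sup>2 * \<epsilon> ^ 4"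
    proof -
      obtain \<delta> where \<delta>: "\<delta> > 0"
          "\<And>z. z \<noteq> 0 \<Longrightarrow> cmod z < \<delta> \<Longrightarrow> cmod (k z - 1 - c 1 * z - c 2 * z ^ 2) \<le> C * cmod z ^ 3"
        using C unfolding eventually_at by (auto simp: dist_norm)
      have "\<forall>\<^sub>F \<epsilon> in at_right 0. \<epsilon> < \<delta> \<and> \<epsilon> < r \<and> 0 < \<epsilon> \<and> a * \<epsilon>\<^sup>2 < 1"
      proof (intro eventually_conj)
        have "((\<lambda>\<epsilon>. a * \<epsilon>\<^sup>2) \<longlongrightarrow> a * 0\<^sup>2) (at_right 0)" by (intro tendsto_intros)
        then show "\<forall>\<^sub>F \<epsilon> in at_right 0. a * \<epsilon>\<^sup>2 < 1" by (intro order_tendstoD) auto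
        show "\<forall>\<^sub>F \<epsilon> in at_right 0. \<epsilon> < \<delta>" "\<forall>\<^sub>F \<epsilon> in at_right 0. \<epsilon> < r"
          using \<delta>(1) r by (auto intro: eventually_at_rightI[of 0])
      qed (simp add: eventually_at_right_less)
      then show ?thesis
      proof eventually_elim
        case (elim \<epsilon>)
        have cb: "cmod (k z / z - c 1 - (c 2 * \<epsilon>\<^sup>2) * cnj (k z / z - c 1)) \<le> 1 / \<epsilon> + C' * \<epsilon>\<^sup>2"
          if z: "cmod z = \<epsilon>" for z
        proof -
          have nz: "z \<noteq> 0" using z elim by auto
          define e where "e = (k z - 1 - c 1 * z - c 2 * z ^ 2) / z"
          have "cmod e \<le> C * \<epsilon> ^ 3 / \<epsilon>"
            using \<delta>(2)[OF nz] z elim by (simp add: e_def norm_divide divide_right_mono)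
          also have "\<dots> \<le> \<bar>C\<bar> * \<epsilon>\<^sup>2"
            using elim by (simp add: power3_eq_cube power2_eq_square mult_right_mono)
          finally have e: "cmod e \<le> \<bar>C\<bar> * \<epsilon>\<^sup>2" .
          have u: "k z / z - c 1 = 1 / z + c 2 * z + e"
            using nz by (simp add: e_def field_simps power2_eq_square)
          \<comment> \<open>On the circle, \<epsilon>^2 cnj (1/z) = z. This choice of \<mu>
            therefore removes the linear term c_2 z exactly.\<close>
          have "z * cnj z = complex_of_real (\<epsilon>\<^sup>2)" using z by (simp flip: complex_norm_square)
          then have "\<epsilon>\<^sup>2 * cnj (1 / z) = z" using nz by (simp add: field_simps)
          then have "c 2 * (\<epsilon>\<^sup>2 * cnj (1 / z)) = c 2 * z" by simp
          then have "k z / z - c 1 - (c 2 * \<epsilon>\<^sup>2) * cnj (k z / z - c 1)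
              = 1 / z + (e - (c 2 * \<epsilon>\<^sup>2) * (cnj (c 2) * cnj z) - (c 2 * \<epsilon>\<^sup>2) * cnj e)"
            unfolding u by (simp add: algebra_simps)
          also have "cmod \<dots> \<le> 1 / \<epsilon> + (cmod e + a * \<epsilon>\<^sup>2 * (a * \<epsilon>) + a * \<epsilon>\<^sup>2 * cmod e)"
            by (intro order.trans[OF norm_triangle_ineq] order.trans[OF norm_triangle_ineq4] add_mono)
               (auto simp: norm_mult norm_divide norm_power z a_def)
          also have "\<dots> \<le> 1 / \<epsilon> + C' * \<epsilon>\<^sup>2"
          proof -
            have e1: "\<epsilon> \<le> 1" "0 \<le> a" using elim r by (auto simp: a_def)
            have "a * \<epsilon>\<^sup>2 * (a * \<epsilon>) \<le> a * \<epsilon>\<^sup>2 * (a * 1)"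
              using e1 elim by (intro mult_left_mono) auto
            moreover have "a * \<epsilon>\<^sup>2 * cmod e \<le> a * 1 * (\<bar>C\<bar> * \<epsilon>\<^sup>2)"
              using e1 elim e by (intro mult_mono) (auto simp: power_le_one)
            ultimately show ?thesis
              using e by (simp add: C'_def algebra_simps power2_eq_square)
          qed
          finally show ?thesis .
        qed
        have "(1 - (cmod (c 2 * \<epsilon>\<^sup>2))\<^sup>2) * ((T r - 1 / r\<^sup>2) - (T \<epsilon> - 1 / \<epsilon>\<^sup>2)) \<le> (1 / \<epsilon> + C' * \<epsilon>\<^sup>2)\<^sup>2"
          unfolding T_def
          by (rule area_inequality_annulus[OF k k0 inj, folded c_def])
             (use elim r cb in \<open>auto simp: norm_mult norm_power a_def\<close>)
        moreover have "cmod (c 2 * \<epsilon>\<^sup>2) = a * \<epsilon>\<^sup>2" by (simp add: norm_mult a_def norm_power)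
        ultimately have "(1 - (a * \<epsilon>\<^sup>2)\<^sup>2) * ((T r - 1 / r\<^sup>2) - T \<epsilon>) + (1 - (a * \<epsilon>\<^sup>2)\<^sup>2) / \<epsilon>\<^sup>2 \<le> (1 / \<epsilon> + C' * \<epsilon>\<^sup>2)\<^sup>2"
          by (simp add: right_diff_distrib)
        moreover have "(1 - (a * \<epsilon>\<^sup>2)\<^sup>2) / \<epsilon>\<^sup>2 = 1 / \<epsilon>\<^sup>2 - a\<^sup>2 * \<epsilon>\<^sup>2"
          using elim by (simp add: field_simps power2_eq_square)
        moreover have "(1 / \<epsilon> + C' * \<epsilon>\<^sup>2)\<^sup>2 = 1 / \<epsilon>\<^sup>2 + 2 * C' * \<epsilon> + C'\<^sup>2 * \<epsilon> ^ 4"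
          using elim by (simp add: field_simps power2_eq_square power4_eq_xxxx)
        ultimately show ?case by linarith
      qed
    qed
    moreover have "((\<lambda>\<epsilon>. (1 - (a * \<epsilon>\<^sup>2)\<^sup>2) * ((T r - 1 / r\<^sup>2) - T \<epsilon>)) \<longlongrightarrow>
        (1 - (a * 0\<^sup>2)\<^sup>2) * ((T r - 1 / r\<^sup>2) - T 0)) (at_right 0)"
      unfolding T_def by (intro tendsto_intros)
    moreover have "((\<lambda>\<epsilon>. a\<^sup>2 * \<epsilon>\<^sup>2 + 2 * C' * \<epsilon> + C'\<^sup>2 * \<epsilon> ^ 4) \<longlongrightarrow>
        a\<^sup>2 * 0\<^sup>2 + 2 * C' * 0 + C'\<^sup>2 * 0 ^ 4) (at_right 0)"
      by (intro tendsto_intros)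
    ultimately have "(1 - (a * 0\<^sup>2)\<^sup>2) * ((T r - 1 / r\<^sup>2) - T 0) \<le> a\<^sup>2 * 0\<^sup>2 + 2 * C' * 0 + C'\<^sup>2 * 0 ^ 4"
      by (intro tendsto_le[OF trivial_limit_at_right_real])
    moreover have "T 0 = 0" unfolding T_def by (rule sum.neutral) auto
    ultimately show ?thesis by simp
  qed
  have "T 1 \<le> 1 / 1\<^sup>2"
  proof (rule tendsto_le[OF trivial_limit_at_left_real])
    show "(T \<longlongrightarrow> T 1) (at_left 1)" unfolding T_def by (intro tendsto_intros)
    show "((\<lambda>r. 1 / r\<^sup>2) \<longlongrightarrow> 1 / (1::real)\<^sup>2) (at_left 1)" by (intro tendsto_intros) simp
    show "\<forall>\<^sub>F r in at_left 1. T r \<le> 1 / r\<^sup>2"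
      using step by (intro eventually_at_leftI[of 0]) auto
  qed
  then show ?thesis by (simp add: T_def c_def)
qed

subsection \<open>Logarithmic coefficients\<close>

text \<open>Comparing coefficients in E' = - (F' / 2) E, where E = exp (- F / 2), gives a recursion
  that is solved for the first three indices.\<close>

lemma fps_expansion_exp_coeffs:
  assumes F: "F holomorphic_on ball 0 1" and F0: "F 0 = 0"
  defines "g \<equiv> (\<lambda>n. fps_nth (fps_expansion F 0) n / 2)"
    and "e \<equiv> fps_nth (fps_expansion (\<lambda>z. exp (- F z / 2)) 0)"
  shows "e 1 = - g 1" "e 2 = (g 1)\<^sup>2 / 2 - g 2" "e 3 = - g 3 + g 1 * g 2 - (g 1) ^ 3 / 6"
proof -
  define E where "E = (\<lambda>z. exp (- F z / 2))"
  have "E holomorphic_on ball 0 1" unfolding E_def by (intro holomorphic_intros F) auto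
  then have Efps: "E has_fps_expansion fps_expansion E 0"
    by (intro has_fps_expansion_fps_expansion[of "ball 0 1"]) auto
  have Ffps: "F has_fps_expansion fps_expansion F 0"
    using F by (intro has_fps_expansion_fps_expansion[of "ball 0 1"]) auto
  have "(\<lambda>z. E z * (- 1 / 2 * deriv F z)) has_fps_expansion fps_expansion E 0 * (fps_const (- 1 / 2) * fps_deriv (fps_expansion F 0))"
    by (intro fps_expansion_intros Efps has_fps_expansion_deriv Ffps)
  moreover have "deriv E has_fps_expansion fps_deriv (fps_expansion E 0)"
    by (intro has_fps_expansion_deriv Efps)
  moreover have "\<forall>\<^sub>F z in nhds 0. deriv E z = E z * (- 1 / 2 * deriv F z)"
  proof -
    have "\<forall>\<^sub>F z in nhds 0. z \<in> ball (0::complex) 1"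
      by (intro eventually_nhds_in_open) auto
    then show ?thesis
    proof eventually_elim
      case (elim z)
      have "(F has_field_derivative deriv F z) (at z)"
        using elim by (intro holomorphic_derivI[OF F]) auto
      then have "(E has_field_derivative E z * (- 1 / 2 * deriv F z)) (at z)"
        unfolding E_def by (auto intro!: derivative_eq_intros)
      then show ?case by (rule DERIV_imp_deriv)
    qed
  qed
  ultimately have ode: "fps_deriv (fps_expansion E 0) =
      fps_expansion E 0 * (fps_const (- 1 / 2) * fps_deriv (fps_expansion F 0))"
    using has_fps_expansion_cong fps_expansion_unique_complex by metis
  have e0: "e 0 = 1" by (simp add: e_def fps_expansion_def F0)
  have rec: "of_nat (Suc n) * e (Suc n) = (\<Sum>i=0..n. e i * (- of_nat (Suc (n - i)) * g (Suc (n - i))))" for n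
  proof -
    have "fps_nth (fps_deriv (fps_expansion E 0)) n = of_nat (Suc n) * e (Suc n)"
      by (simp add: e_def E_def)
    moreover have "fps_nth (fps_expansion E 0 * (fps_const (- 1 / 2) * fps_deriv (fps_expansion F 0))) n =
       (\<Sum>i=0..n. e i * (- of_nat (Suc (n - i)) * g (Suc (n - i))))"
      unfolding fps_mult_nth[of "fps_expansion E 0"] fps_mult_left_const_nth fps_deriv_nth e_def g_def
      unfolding E_def
      by (intro sum.cong) (auto simp: algebra_simps)
    ultimately show ?thesis using ode by simp
  qed
  show e1: "e 1 = - g 1" using rec[of 0] e0 by simp
  show e2: "e 2 = (g 1)\<^sup>2 / 2 - g 2"
    using rec[of 1] e0 e1 by (simp add: numeral_2_eq_2 power2_eq_square field_simps)
  have "3 * e 3 = - 3 * g 3 + 2 * g 1 * g 2 - g 1 * e 2"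
    using rec[of 2] e0 e1 by (simp add: numeral_3_eq_3 numeral_2_eq_2 algebra_simps)
  then show "e 3 = - g 3 + g 1 * g 2 - (g 1) ^ 3 / 6"
    unfolding e2 by (simp add: power2_eq_square power3_eq_cube field_simps)
qed

lemma hankel2_log_quotient:
  assumes "f \<in> class_S"
  shows "hankel2 1 (\<lambda>z. log_quotient f z / 2) = log_coeff f 1 * log_coeff f 3 - (log_coeff f 2)\<^sup>2"
proof -
  have hol: "log_quotient f holomorphic_on ball 0 1"
    using is_log_quotient_log_quotient[OF assms] by (simp add: is_log_quotient_def)
  then have "log_quotient f has_fps_expansion fps_expansion (log_quotient f) 0"
    by (intro has_fps_expansion_fps_expansion[of "ball 0 1"]) auto
  then have "(\<lambda>z. log_quotient f z * (1 / 2)) has_fps_expansion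
      fps_expansion (log_quotient f) 0 * fps_const (1 / 2)"
    by (intro fps_expansion_intros)
  then have "fps_expansion (\<lambda>z. log_quotient f z / 2) 0 =
      fps_expansion (log_quotient f) 0 * fps_const (1 / 2)"
    using fps_expansion_eqI by simp
  then have "fps_nth (fps_expansion (\<lambda>z. log_quotient f z / 2) 0) n = log_coeff f n" for n
    by (simp only: fps_mult_right_const_nth log_coeff_def) simp
  then show ?thesis
    by (simp add: hankel2_def det_2 power2_eq_square numeral_3_eq_3 numeral_2_eq_2)
qed

text \<open>With x, y, z the three moduli, x z <= x^2/4 + z^2 and x^4 <= x^2 bound the left side by
  x^2/3 + y^2 + z^2, since 1/4 + 1/12 = 1/3. This is at most a third of the assumed sum.\<close>

lemma cmod_coeff_functional_le:
  fixes e1 e2 e3 :: complex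
  assumes "(cmod e1)\<^sup>2 + 3 * (cmod e2)\<^sup>2 + 5 * (cmod e3)\<^sup>2 \<le> 1"
  shows "cmod (e1 * e3 - e2\<^sup>2 + e1 ^ 4 / 12) \<le> 1 / 3"
proof -
  define x y z where "x = cmod e1" and "y = cmod e2" and "z = cmod e3"
  have xyz: "x\<^sup>2 + 3 * y\<^sup>2 + 5 * z\<^sup>2 \<le> 1" using assms by (simp add: x_def y_def z_def)
  have "cmod (e1 * e3 - e2\<^sup>2 + e1 ^ 4 / 12) \<le> x * z + y\<^sup>2 + x ^ 4 / 12"
    unfolding x_def y_def z_def
    by (intro order.trans[OF norm_triangle_ineq] order.trans[OF norm_triangle_ineq4] add_mono)
       (auto simp: norm_mult norm_power norm_divide)
  also have "x ^ 4 \<le> x\<^sup>2"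
  proof -
    have "x\<^sup>2 \<le> 1" using xyz by (smt (verit) zero_le_power2)
    then have "x\<^sup>2 * x\<^sup>2 \<le> x\<^sup>2 * 1" by (intro mult_left_mono) auto
    then show ?thesis by (simp add: power2_eq_square power4_eq_xxxx mult.assoc)
  qed
  also have "x * z + y\<^sup>2 + x\<^sup>2 / 12 \<le> 1 / 3"
  proof -
    have "0 \<le> (x - 2 * z)\<^sup>2" by simp
    then have "x * z \<le> x\<^sup>2 / 4 + z\<^sup>2" by (simp add: power2_eq_square algebra_simps)
    moreover have "0 \<le> z\<^sup>2" by simp
    ultimately show ?thesis using xyz by linarith
  qed
  finally show ?thesis by simp
qed

theorem theorem3:
  fixes f :: "complex \<Rightarrow> complex"
  assumes "f \<in> class_S"
  shows "cmod (hankel2 1 (\<lambda>z. log_quotient f z / 2))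
           = cmod (log_coeff f 1 * log_coeff f 3 - (log_coeff f 2)\<^sup>2)
       \<and> cmod (log_coeff f 1 * log_coeff f 3 - (log_coeff f 2)\<^sup>2) \<le> 1 / 3"
proof
  show "cmod (hankel2 1 (\<lambda>z. log_quotient f z / 2))
           = cmod (log_coeff f 1 * log_coeff f 3 - (log_coeff f 2)\<^sup>2)"
    using assms by (simp only: hankel2_log_quotient)
next
  define F where "F = log_quotient f"
  have F: "F holomorphic_on ball 0 1" "F 0 = 0"
    and expF: "\<And>z. z \<in> ball 0 1 \<Longrightarrow> z \<noteq> 0 \<Longrightarrow> exp (F z) = f z / z"
    using is_log_quotient_log_quotient[OF assms] by (auto simp: is_log_quotient_def F_def)
  have injf: "inj_on f (ball 0 1)" using assms by (simp add: class_S_def)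
  define E where "E = (\<lambda>z. exp (- F z / 2))"
  define k where "k = E \<circ> (\<lambda>z. z\<^sup>2)"
  define e where "e = fps_nth (fps_expansion E 0)"
  have E: "E holomorphic_on ball 0 1" unfolding E_def by (intro holomorphic_intros F) auto
  have sq: "z\<^sup>2 \<in> ball 0 1" if "z \<in> ball 0 1" for z :: complex
    using that by (simp add: norm_power power_less_one_iff abs_square_less_1)
  have k: "k holomorphic_on ball 0 1"
    unfolding k_def using sq by (intro holomorphic_on_compose_gen[OF _ E] holomorphic_intros) auto
  have k0: "k 0 = 1" by (simp add: k_def E_def F)
  \<comment> \<open>Squaring gives the relation to \<open>f\<close> without choosing a branch of the
    square root.\<close>
  have kk: "(k z / z)\<^sup>2 = 1 / f (z\<^sup>2)" if "z \<in> ball 0 1" "z \<noteq> 0" for z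
  proof -
    have "(k z)\<^sup>2 = exp (- F (z\<^sup>2))"
      by (simp add: k_def E_def flip: exp_double)
    then have "(k z)\<^sup>2 = 1 / exp (F (z\<^sup>2))"
      by (simp add: exp_minus inverse_eq_divide)
    then show ?thesis using expF[OF sq[OF that(1)]] that by (simp add: power_divide)
  qed
  have knz: "k z \<noteq> 0" and k_minus: "k (- z) = k z" for z
    by (simp_all add: k_def E_def)
  have inj: "inj_on (\<lambda>z. k z / z) (ball 0 1 - {0})"
  proof (rule inj_onI)
    fix z w assume zw: "z \<in> ball 0 1 - {0}" "w \<in> ball 0 1 - {0}" "k z / z = k w / w"
    then have "1 / f (z\<^sup>2) = 1 / f (w\<^sup>2)"
      using kk[of z] kk[of w] by simp
    then have "z\<^sup>2 = w\<^sup>2"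
      using inj_onD[OF injf, of "z\<^sup>2" "w\<^sup>2"] sq zw by simp
    then have "z = w \<or> z = - w" by (simp add: power2_eq_iff)
    \<comment> \<open>Squaring loses the sign. Since \<open>k\<close> is even, k z / z is odd, and
      it has no zeros, so opposite points have different values.\<close>
    moreover have "z \<noteq> - w"
    proof
      assume "z = - w"
      then have "- (k w / w) = k w / w" using zw(3) by (simp add: k_minus)
      then show False using knz[of w] zw(2) by simp
    qed
    ultimately show "z = w" by blast
  qed
  have "E has_fps_expansion fps_expansion E 0"
    using E by (intro has_fps_expansion_fps_expansion[of "ball 0 1"]) auto
  then have "k has_fps_expansion fps_compose (fps_expansion E 0) (fps_X ^ 2)"
    unfolding k_def by (intro fps_expansion_intros) auto
  then have kc: "fps_nth (fps_expansion k 0) n = (if even n then e (n div 2) else 0)" for n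
    by (simp add: fps_expansion_eqI fps_nth_compose_X_power e_def)
  \<comment> \<open>The index n meets the coefficient of \<open>k\<close> at n + 1, which is zero
    for even n; n = 1, 3, 5 meet \<open>e 1\<close>, \<open>e 2\<close>, \<open>e 3\<close> and
    supply the weights 1, 3, 5.\<close>
  have "{1..5::nat} = {1, 2, 3, 4, 5}" by auto
  then have "(cmod (e 1))\<^sup>2 + 3 * (cmod (e 2))\<^sup>2 + 5 * (cmod (e 3))\<^sup>2 \<le> 1"
    using area_theorem[OF k k0 inj, of 5] by (simp add: kc)
  then have "cmod (e 1 * e 3 - (e 2)\<^sup>2 + e 1 ^ 4 / 12) \<le> 1 / 3"
    by (rule cmod_coeff_functional_le)
  moreover have e_eq: "e 1 = - log_coeff f 1" "e 2 = (log_coeff f 1)\<^sup>2 / 2 - log_coeff f 2"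
      "e 3 = - log_coeff f 3 + log_coeff f 1 * log_coeff f 2 - (log_coeff f 1) ^ 3 / 6"
    using fps_expansion_exp_coeffs[OF F] by (simp_all only: log_coeff_def F_def E_def e_def)
  \<comment> \<open>In e_1 e_3 - e_2^2 the mixed terms \<gamma>_1^2 \<gamma>_2 cancel, and 1/6 - 1/4
    = -1/12 leaves - \<gamma>_1^4 / 12. As e_1 = - \<gamma>_1, adding e_1^4 / 12 compensates
    it.\<close>
  have "log_coeff f 1 * log_coeff f 3 - (log_coeff f 2)\<^sup>2 = e 1 * e 3 - (e 2)\<^sup>2 + e 1 ^ 4 / 12"
    unfolding e_eq by (simp add: power2_eq_square power3_eq_cube power4_eq_xxxx field_simps)
  ultimately show "cmod (log_coeff f 1 * log_coeff f 3 - (log_coeff f 2)\<^sup>2) \<le> 1 / 3"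
    by simp
qed

end
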